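(* (Modified Kirchhoff model, entropy condition.) Let $\lambda,\mu,\rho_0>0$, put $\alpha=\lambda/\mu$, and for $\Gamma>-1$ let $$P(\Gamma)=\frac1{\rho_0}\Big(\mu(1+\Gamma)^3-\mu(1+\Gamma)+\lambda\frac{\ln(1+\Gamma)}{1+\Gamma}\Big).$$ For $\Gamma_l\in(-1,0)$ write $s=1+\Gamma_l\in(0,1)$. (i) If $\alpha\ge2$, then $S(\Gamma_l)$ satisfies the entropy condition for the standard entropy function for all $s\in(0,1)$. (ii) If $0<\alpha<2$, then the equation $$\frac{s(s+1)(1-s)^3}{2(s-1-s\ln s)\ln s}=\alpha$$ has a unique solution $s_e\in(0,1)$, and $S(\Gamma_l)$ satisfies the entropy condition for the standard entropy function for all $s\in(0,s_e]$ and does not satisfy it for $s\in(s_e,1)$.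
   Context: The p-system is $V_t-(P(\Gamma))_X=0$, $\Gamma_t-V_X=0$, with $\Gamma>-1$. The compression shock $S(\Gamma_l)$ is $(V,\Gamma)=(-V_0,0)$ for $X>\sigma t$, $(V,\Gamma)=(0,\Gamma_l)$ for $X<\sigma t$, with $V_0=\sqrt{\Gamma_lP(\Gamma_l)}$, $\sigma=-V_0/\Gamma_l$. The standard entropy/entropy-flux pair is $\Phi(V,\Gamma)=\frac{V^2}{2}+\int_0^\Gamma P(w)\,dw$, $\Psi(V,\Gamma)=-P(\Gamma)V$; for $S(\Gamma_l)$ the corresponding entropy condition is by definition the inequality $2\int_0^{\Gamma_l}P(w)\,dw\le\Gamma_lP(\Gamma_l)$. *)

theory Defs
  imports "HOL-Analysis.Analysis"
begin

(* P-system: V_t - (P \<Gamma>)_X = 0, \<Gamma>_t - V_X = 0. The interval integral is oriented, so for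
   \<Gamma> < 0 it is minus the integral over the interval from \<Gamma> to 0, as in the usual convention. *)

definition std_entropy :: "(real \<Rightarrow> real) \<Rightarrow> real \<Rightarrow> real \<Rightarrow> real" where
  "std_entropy P V \<Gamma> = V\<^sup>2 / 2 + (LBINT w=0..\<Gamma>. P w)"

definition std_entropy_flux :: "(real \<Rightarrow> real) \<Rightarrow> real \<Rightarrow> real \<Rightarrow> real" where
  "std_entropy_flux P V \<Gamma> = - P \<Gamma> * V"

definition shock_V0 :: "(real \<Rightarrow> real) \<Rightarrow> real \<Rightarrow> real" where
  "shock_V0 P \<Gamma>\<^sub>l = sqrt (\<Gamma>\<^sub>l * P \<Gamma>\<^sub>l)"

definition shock_speed :: "(real \<Rightarrow> real) \<Rightarrow> real \<Rightarrow> real" where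
  "shock_speed P \<Gamma>\<^sub>l = - shock_V0 P \<Gamma>\<^sub>l / \<Gamma>\<^sub>l"

(* The shock S(\<Gamma>l) has the left state (0, \<Gamma>l) and the right state (-V0, 0). *)

definition entropy_condition :: "(real \<Rightarrow> real) \<Rightarrow> real \<Rightarrow> bool" where
  "entropy_condition P \<Gamma>\<^sub>l \<longleftrightarrow> 2 * (LBINT w=0..\<Gamma>\<^sub>l. P w) \<le> \<Gamma>\<^sub>l * P \<Gamma>\<^sub>l"

(* The inequality defining the entropy condition is the jump form of \<Phi>_t + \<Psi>_X \<le> 0 across the
   shock, i.e. -\<sigma> (\<Phi>_right - \<Phi>_left) + (\<Psi>_right - \<Psi>_left) \<le> 0. *)

lemma entropy_condition_iff_jump:
  assumes "\<Gamma>\<^sub>l < 0" "P \<Gamma>\<^sub>l < 0" "P 0 = 0"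
  shows "entropy_condition P \<Gamma>\<^sub>l \<longleftrightarrow>
    - shock_speed P \<Gamma>\<^sub>l *
        (std_entropy P (- shock_V0 P \<Gamma>\<^sub>l) 0 - std_entropy P 0 \<Gamma>\<^sub>l)
      + (std_entropy_flux P (- shock_V0 P \<Gamma>\<^sub>l) 0 - std_entropy_flux P 0 \<Gamma>\<^sub>l) \<le> 0"
proof -
  have pos: "\<Gamma>\<^sub>l * P \<Gamma>\<^sub>l > 0"
    using assms by (simp add: mult_neg_neg)
  then have "shock_speed P \<Gamma>\<^sub>l > 0"
    using assms(1) by (simp add: shock_speed_def shock_V0_def divide_pos_neg)
  then have *: "0 \<le> shock_speed P \<Gamma>\<^sub>l * x \<longleftrightarrow> 0 \<le> x" for x
    by (simp add: zero_le_mult_iff)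
  have "(shock_V0 P \<Gamma>\<^sub>l)\<^sup>2 = \<Gamma>\<^sub>l * P \<Gamma>\<^sub>l"
    using pos by (simp add: shock_V0_def)
  moreover have "(LBINT w=0..ereal 0. P w) = 0"
    by (simp add: zero_ereal_def[symmetric])
  ultimately show ?thesis
    using assms(3) unfolding std_entropy_def std_entropy_flux_def entropy_condition_def
    by (simp add: *) linarith
qed

definition kirchhoff_P :: "real \<Rightarrow> real \<Rightarrow> real \<Rightarrow> real \<Rightarrow> real" where
  "kirchhoff_P lam mu rho0 \<Gamma> =
    (1 / rho0) * (mu * (1 + \<Gamma>) ^ 3 - mu * (1 + \<Gamma>) + lam * (ln (1 + \<Gamma>) / (1 + \<Gamma>)))"

end

(* With s = 1 + \<Gamma>l, integrating P explicitly turns the entropy condition into f(s) \<le> \<alpha>, where f is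
   the left-hand side of the equation for s_e. Up to the factor 1/2, f is the product of
   (1 - s) / (- ln s) and s (s + 1) (1 - s)^2 / (1 - s + s ln s), and both factors are positive and
   strictly increasing on (0,1). Since f tends to 0 at 0 and to 2 at 1, everything follows. *)
theory Submission
  imports Defs "HOL-Real_Asymp.Real_Asymp"
begin

section \<open>Monotonicity of the ratio on (0,1)\<close>

definition kirchhoff_ratio :: "real \<Rightarrow> real" where
  "kirchhoff_ratio s = s * (s + 1) * (1 - s) ^ 3 / (2 * (s - 1 - s * ln s) * ln s)"

text \<open>The strict tangent bound ln t < t - 1 at t = 1/s, multiplied by s. It supplies the signs
  of \<open>s - 1 - s * ln s\<close> and of its negative in the denominators below.\<close>

lemma x_ln_x_gt:
  assumes "0 < (s::real)" "s < 1"
  shows "s - 1 < s * ln s"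
proof -
  have "ln (1 / s) < 1 / s - 1"
    using assms ln_eq_minus_one[of "1 / s"] ln_le_minus_one[of "1 / s"]
    by (auto simp: less_le)
  then have "s * (- ln s) < s * (1 / s - 1)"
    using assms by (intro mult_strict_left_mono) (auto simp: ln_div)
  then show ?thesis using assms by (simp add: right_diff_distrib)
qed

lemma strict_mono_on_deriv_pos:
  fixes f :: "real \<Rightarrow> real"
  assumes "\<And>x. 0 < x \<Longrightarrow> x < 1 \<Longrightarrow> \<exists>y. (f has_real_derivative y) (at x) \<and> y > 0"
  shows "strict_mono_on {0<..<1} f"
proof (rule strict_mono_onI)
  fix a b :: real assume "a \<in> {0<..<1}" "b \<in> {0<..<1}" "a < b"
  then show "f a < f b"
    using assms by (intro DERIV_pos_imp_increasing[OF \<open>a < b\<close>]) auto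
qed

text \<open>The quotient is the logarithmic mean of s and 1. Differentiation leaves the numerator
  \<open>1 - x + x * ln x\<close>, positive by \<open>x_ln_x_gt\<close>.\<close>

lemma log_mean_one_strict_mono:
  "strict_mono_on {0<..<1} (\<lambda>s::real. (1 - s) / (- ln s))"
proof (rule strict_mono_on_deriv_pos)
  fix x :: real assume x: "0 < x" "x < 1"
  have "((\<lambda>s. (1 - s) / (- ln s)) has_real_derivative
      (1 - x + x * ln x) / (x * (ln x)\<^sup>2)) (at x)"
    using x by (auto intro!: derivative_eq_intros simp: divide_simps power2_eq_square) (simp add: algebra_simps)?
  moreover have "(1 - x + x * ln x) / (x * (ln x)\<^sup>2) > 0"
    using x x_ln_x_gt[OF x] by simp
  ultimately show "\<exists>y. ((\<lambda>s. (1 - s) / (- ln s)) has_real_derivative y) (at x) \<and> y > 0"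
    by blast
qed

text \<open>Needed for the sign of the derivative of the second factor. Dividing by the positive
  polynomial beside \<open>ln s\<close> isolates the logarithm, so that one differentiation leaves a
  rational function of evident sign.\<close>

lemma neg_ln_gt_rational:
  assumes "0 < (s::real)" "s < 1"
  shows "s\<^sup>2 * (1 + 3 * s) * ln s < (1 - s) * (1 - s - 4 * s\<^sup>2)"
proof -
  define h where "h = (\<lambda>s::real. ln s - (1 - s) * (1 - s - 4 * s\<^sup>2) / (s\<^sup>2 * (1 + 3 * s)))"
  \<comment> \<open>Here \<open>h 1 = 0\<close>. The derivative of \<open>h\<close> has a double
    zero at 1, so its positivity is used on the open interval, with continuity up to the
    endpoint.\<close>
  have "h s < h 1"
  proof (rule DERIV_pos_imp_increasing_open[OF \<open>s < 1\<close>])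
    fix x :: real assume x: "s < x" "x < 1"
    then have x0: "x > 0" using assms by simp
    have "(h has_real_derivative
        (1 - x)\<^sup>2 * (1 + x) * (9 * x + 2) / (x ^ 3 * (1 + 3 * x)\<^sup>2)) (at x)"
      unfolding h_def using x0
      by (auto intro!: derivative_eq_intros) (simp add: divide_simps, algebra)
    moreover have "(1 - x)\<^sup>2 * (1 + x) * (9 * x + 2) / (x ^ 3 * (1 + 3 * x)\<^sup>2) > 0"
      using x x0 by (intro divide_pos_pos mult_pos_pos) auto
    ultimately show "\<exists>y. (h has_real_derivative y) (at x) \<and> y > 0" by blast
  next
    show "continuous_on {s..1} h"
      unfolding h_def using assms by (auto intro!: continuous_intros)
  qed
  then have "ln s < (1 - s) * (1 - s - 4 * s\<^sup>2) / (s\<^sup>2 * (1 + 3 * s))"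
    by (simp add: h_def)
  moreover have "s\<^sup>2 * (1 + 3 * s) > 0" using assms by simp
  ultimately show ?thesis by (simp add: pos_less_divide_eq mult.commute)
qed

lemma kirchhoff_second_factor_strict_mono:
  "strict_mono_on {0<..<1} (\<lambda>s::real. s * (s + 1) * (1 - s)\<^sup>2 / (1 - s + s * ln s))"
proof (rule strict_mono_on_deriv_pos)
  fix x :: real assume x: "0 < x" "x < 1"
  define D where "D = 1 - x + x * ln x"
  have D: "D > 0" using x_ln_x_gt[OF x] by (simp add: D_def)
  let ?y = "(1 - x) * ((1 - x) * (1 - x - 4 * x\<^sup>2) - x\<^sup>2 * (1 + 3 * x) * ln x) / D\<^sup>2"
  have "((\<lambda>s. s * (s + 1) * (1 - s)\<^sup>2 / (1 - s + s * ln s)) has_real_derivative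
      (((1 - 2 * x - 3 * x\<^sup>2 + 4 * x ^ 3) * D - x * (x + 1) * (1 - x)\<^sup>2 * ln x) / D\<^sup>2)) (at x)"
    using x D unfolding D_def
    by (auto intro!: derivative_eq_intros simp: power2_eq_square) (simp add: field_simps power3_eq_cube)?
  \<comment> \<open>The cubic equals (1 - x)(1 - x - 4x^2), so 1 - x splits off from both terms;
    collecting the multiples of \<open>ln x\<close> leaves exactly the difference of the two sides
    of \<open>neg_ln_gt_rational\<close>.\<close>
  moreover have "(1 - 2 * x - 3 * x\<^sup>2 + 4 * x ^ 3) * D - x * (x + 1) * (1 - x)\<^sup>2 * ln x
      = (1 - x) * ((1 - x) * (1 - x - 4 * x\<^sup>2) - x\<^sup>2 * (1 + 3 * x) * ln x)"
    unfolding D_def by algebra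
  moreover have "?y > 0"
    using x D neg_ln_gt_rational[OF x] by (intro divide_pos_pos mult_pos_pos) auto
  ultimately show "\<exists>y. ((\<lambda>s. s * (s + 1) * (1 - s)\<^sup>2 / (1 - s + s * ln s)) has_real_derivative y)
      (at x) \<and> y > 0"
    by auto
qed

lemma kirchhoff_ratio_strict_mono: "strict_mono_on {0<..<1} kirchhoff_ratio"
proof (rule strict_mono_onI)
  fix a b :: real assume ab: "a \<in> {0<..<1}" "b \<in> {0<..<1}" "a < b"
  define u where "u = (\<lambda>s::real. (1 - s) / (- ln s))"
  define v where "v = (\<lambda>s::real. s * (s + 1) * (1 - s)\<^sup>2 / (1 - s + s * ln s))"
  \<comment> \<open>The sign changes in \<open>- ln s\<close> and \<open>1 - s + s * ln s\<close>
    cancel.\<close>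
  have eq: "kirchhoff_ratio s = u s * v s / 2" if "s \<in> {0<..<1}" for s
  proof -
    have "ln s \<noteq> 0" "s - 1 - s * ln s \<noteq> 0" "1 - s + s * ln s \<noteq> 0"
      using that x_ln_x_gt[of s] by auto
    then show ?thesis
      unfolding kirchhoff_ratio_def u_def v_def
      by (simp add: divide_simps) algebra
  qed
  \<comment> \<open>The products are compared through \<open>u a * v b\<close>, which calls for
    these two signs.\<close>
  have "u a > 0" "v b > 0"
    using ab x_ln_x_gt[of b] unfolding u_def v_def
    by (intro divide_pos_pos mult_pos_pos; simp)+
  moreover have "u a < u b" "v a < v b"
    using ab strict_mono_onD[OF log_mean_one_strict_mono, of a b]
      strict_mono_onD[OF kirchhoff_second_factor_strict_mono, of a b]
    unfolding u_def v_def by blast+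
  ultimately have "u a * v a < u b * v b"
    by (smt (verit) mult_strict_left_mono mult_strict_right_mono)
  then show "kirchhoff_ratio a < kirchhoff_ratio b"
    using ab(1,2) by (simp add: eq divide_strict_right_mono)
qed

section \<open>Limits at the endpoints and range of the ratio\<close>

lemma kirchhoff_ratio_tendsto_0: "(kirchhoff_ratio \<longlongrightarrow> 0) (at_right 0)"
  unfolding kirchhoff_ratio_def by real_asymp

text \<open>Source of the threshold \<alpha> = 2: with t = 1 - s the numerator behaves like 2 t^3,
  while ln s ~ -t and s - 1 - s ln s ~ -t^2/2 make the denominator behave like t^3.\<close>

lemma kirchhoff_ratio_tendsto_2: "(kirchhoff_ratio \<longlongrightarrow> 2) (at_left 1)"
  unfolding kirchhoff_ratio_def by real_asymp

lemma kirchhoff_ratio_less_2: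
  assumes "0 < s" "s < 1"
  shows "kirchhoff_ratio s < 2"
proof -
  \<comment> \<open>The limit at 1 yields only a weak bound; it is applied at a point
    \<open>m\<close> between s and 1, and the strict increase from s to \<open>m\<close> restores
    strictness.\<close>
  define m where "m = (s + 1) / 2"
  have m: "s < m" "m < 1" using assms by (auto simp: m_def)
  have "\<forall>\<^sub>F x in at_left 1. kirchhoff_ratio m \<le> kirchhoff_ratio x"
    unfolding eventually_at_left_field
    using assms m strict_mono_onD[OF kirchhoff_ratio_strict_mono, of m]
    by (intro exI[of _ m]) (auto intro: less_imp_le)
  then have "kirchhoff_ratio m \<le> 2"
    by (rule tendsto_lowerbound[OF kirchhoff_ratio_tendsto_2]) simp
  moreover have "kirchhoff_ratio s < kirchhoff_ratio m"
    using assms m by (intro strict_mono_onD[OF kirchhoff_ratio_strict_mono]) auto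
  ultimately show ?thesis by simp
qed

lemma kirchhoff_ratio_surj:
  assumes "0 < a" "a < 2"
  shows "\<exists>s\<in>{0<..<1}. kirchhoff_ratio s = a"
proof -
  \<comment> \<open>The points \<open>p\<close> and \<open>q\<close> are sought on opposite sides of
    1/2, so that \<open>p < q\<close> in the intermediate value theorem.\<close>
  have "\<forall>\<^sub>F x in at_right 0. kirchhoff_ratio x < a \<and> 0 < x \<and> x < 1/2"
    using order_tendstoD(2)[OF kirchhoff_ratio_tendsto_0 assms(1)]
    by (intro eventually_conj) (auto intro: eventually_at_rightI[of 0 "1/2"])
  then obtain p where p: "kirchhoff_ratio p < a" "0 < p" "p < 1/2"
    using eventually_happens'[OF trivial_limit_at_right_real] by blast
  have "\<forall>\<^sub>F x in at_left 1. kirchhoff_ratio x > a \<and> 1/2 < x \<and> x < 1"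
    using order_tendstoD(1)[OF kirchhoff_ratio_tendsto_2 assms(2)]
    by (intro eventually_conj) (auto intro: eventually_at_leftI[of "1/2" 1])
  then obtain q where q: "kirchhoff_ratio q > a" "1/2 < q" "q < 1"
    using eventually_happens'[OF trivial_limit_at_left_real] by blast
  have "x - 1 - x * ln x \<noteq> 0" "ln x \<noteq> 0" if "x \<in> {p..q}" for x
    using that p q x_ln_x_gt[of x] by auto
  then have "continuous_on {p..q} kirchhoff_ratio"
    unfolding kirchhoff_ratio_def using p by (intro continuous_intros) force+
  then obtain s where "p \<le> s" "s \<le> q" "kirchhoff_ratio s = a"
    using IVT'[of kirchhoff_ratio p a q] p q by auto
  then show ?thesis using p q by auto
qed

section \<open>The integral of \<open>P\<close> and the algebraic form of the entropy
  condition\<close>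

lemma kirchhoff_P_integral:
  fixes g :: real
  assumes "g > -1"
  shows "(LBINT w=0..g. kirchhoff_P lam mu rho0 w) =
    (mu * ((1 + g)\<^sup>2 - 1)\<^sup>2 / 4 + lam * (ln (1 + g))\<^sup>2 / 2) / rho0"
proof -
  \<comment> \<open>Antiderivative normalised to vanish at 0: with s = 1 + w, completing the square
    turns s^4/4 - s^2/2 into (s^2 - 1)^2/4 up to a constant.\<close>
  define F where "F = (\<lambda>w. (mu * ((1 + w)\<^sup>2 - 1)\<^sup>2 / 4 + lam * (ln (1 + w))\<^sup>2 / 2) / rho0)"
  have pos: "1 + x > 0" if "x \<in> {min 0 g..max 0 g}" for x
    using that assms by (auto simp: min_def max_def split: if_splits)
  have "(LBINT w=ereal 0..ereal g. kirchhoff_P lam mu rho0 w) = F g - F 0"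
  proof (rule interval_integral_FTC_finite)
    show "continuous_on {min 0 g..max 0 g} (kirchhoff_P lam mu rho0)"
      unfolding kirchhoff_P_def using pos by (intro continuous_intros) force+
    fix x assume "min 0 g \<le> x" "x \<le> max 0 g"
    then have "1 + x > 0" using pos by simp
    then have "((\<lambda>w. mu * ((1 + w)\<^sup>2 - 1)\<^sup>2 / 4 + lam * (ln (1 + w))\<^sup>2 / 2) has_real_derivative
        mu * (1 + x) ^ 3 - mu * (1 + x) + lam * (ln (1 + x) / (1 + x))) (at x)"
      by (auto intro!: derivative_eq_intros) (simp add: divide_simps, algebra)
    then have "(F has_real_derivative kirchhoff_P lam mu rho0 x) (at x)"
      unfolding F_def kirchhoff_P_def using DERIV_cdivide by fastforce
    then show "(F has_vector_derivative kirchhoff_P lam mu rho0 x)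
        (at x within {min 0 g..max 0 g})"
      by (simp add: has_real_derivative_iff_has_vector_derivative has_vector_derivative_at_within)
  qed
  then show ?thesis by (simp add: F_def zero_ereal_def)
qed

lemma entropy_condition_kirchhoff_iff:
  assumes "lam > 0" "mu > 0" "rho0 > 0" "-1 < g" "g < 0"
  shows "entropy_condition (kirchhoff_P lam mu rho0) g \<longleftrightarrow> kirchhoff_ratio (1 + g) \<le> lam / mu"
proof -
  define s where "s = 1 + g"
  define L where "L = ln s"
  have s: "0 < s" "s < 1" using assms by (auto simp: s_def)
  have g: "g = s - 1" by (simp add: s_def)
  have neg: "s - 1 - s * L < 0" "L < 0" using s x_ln_x_gt[of s] by (auto simp: L_def)
  then have pos: "2 * (s - 1 - s * L) * L > 0"
    by (simp add: zero_less_mult_iff)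
  have P: "kirchhoff_P lam mu rho0 g = (mu * s ^ 3 - mu * s + lam * (L / s)) / rho0"
    by (simp add: kirchhoff_P_def g L_def)
  have "entropy_condition (kirchhoff_P lam mu rho0) g \<longleftrightarrow>
      2 * (mu * (s\<^sup>2 - 1)\<^sup>2 / 4 + lam * L\<^sup>2 / 2) / rho0
        \<le> (s - 1) * (mu * s ^ 3 - mu * s + lam * (L / s)) / rho0"
    unfolding entropy_condition_def kirchhoff_P_integral[OF assms(4)] P by (simp add: g L_def)
  also have "\<dots> \<longleftrightarrow> 2 * (mu * (s\<^sup>2 - 1)\<^sup>2 / 4 + lam * L\<^sup>2 / 2)
      \<le> (s - 1) * (mu * s ^ 3 - mu * s + lam * (L / s))"
    using assms(3) by (simp add: divide_le_cancel)
  \<comment> \<open>The factor s clears \<open>L / s\<close>, and the factor 2 clears the half left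
    over from the integral.\<close>
  also have "\<dots> \<longleftrightarrow> 2 * s * (2 * (mu * (s\<^sup>2 - 1)\<^sup>2 / 4 + lam * L\<^sup>2 / 2))
      \<le> 2 * s * ((s - 1) * (mu * s ^ 3 - mu * s + lam * (L / s)))"
    using s by simp
  also have "2 * s * ((s - 1) * (mu * s ^ 3 - mu * s + lam * (L / s)))
      = 2 * (s - 1) * (mu * s ^ 4 - mu * s\<^sup>2 + lam * L)"
    using s by (simp add: field_simps power2_eq_square power3_eq_cube power4_eq_xxxx)
  also have "2 * s * (2 * (mu * (s\<^sup>2 - 1)\<^sup>2 / 4 + lam * L\<^sup>2 / 2)) \<le>
        2 * (s - 1) * (mu * s ^ 4 - mu * s\<^sup>2 + lam * L) \<longleftrightarrow>
      mu * (s * (s + 1) * (1 - s) ^ 3) \<le> lam * (2 * (s - 1 - s * L) * L)"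
  proof -
    \<comment> \<open>The \<open>mu\<close> terms share the factor s (s^2 - 1)(s - 1); what remains
      is 2s - (s + 1) = s - 1, which completes the cube.\<close>
    have "2 * (s - 1) * (mu * s ^ 4 - mu * s\<^sup>2 + lam * L)
        - 2 * s * (2 * (mu * (s\<^sup>2 - 1)\<^sup>2 / 4 + lam * L\<^sup>2 / 2))
      = lam * (2 * (s - 1 - s * L) * L) - mu * (s * (s + 1) * (1 - s) ^ 3)"
      by (simp add: field_simps power2_eq_square power3_eq_cube power4_eq_xxxx)
    then show ?thesis by linarith
  qed
  \<comment> \<open>The denominator is a product of two negative factors, so dividing by it keeps
    the direction.\<close>
  also have "\<dots> \<longleftrightarrow> kirchhoff_ratio s \<le> lam / mu"
    unfolding kirchhoff_ratio_def L_def[symmetric] using pos assms(2)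
    by (simp add: pos_divide_le_eq pos_le_divide_eq mult.commute mult.left_commute)
  finally show ?thesis by (simp add: s_def)
qed

theorem mainTheorem6:
  fixes lam mu rho0 alpha :: real
  assumes "lam > 0" and "mu > 0" and "rho0 > 0"
    and "alpha = lam / mu"
  shows
    "(alpha \<ge> 2 \<longrightarrow>
        (\<forall>\<Gamma>\<^sub>l\<in>{-1<..<0}. entropy_condition (kirchhoff_P lam mu rho0) \<Gamma>\<^sub>l)) \<and>
     (0 < alpha \<and> alpha < 2 \<longrightarrow>
        (\<exists>!s. s \<in> {0<..<1} \<and>
           s * (s + 1) * (1 - s) ^ 3 / (2 * (s - 1 - s * ln s) * ln s) = alpha) \<and>
        (\<forall>s\<^sub>e. s\<^sub>e \<in> {0<..<1} \<and>
           s\<^sub>e * (s\<^sub>e + 1) * (1 - s\<^sub>e) ^ 3 / (2 * (s\<^sub>e - 1 - s\<^sub>e * ln s\<^sub>e) * ln s\<^sub>e) = alpha \<longrightarrow>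
           (\<forall>\<Gamma>\<^sub>l\<in>{-1<..<0}.
              (1 + \<Gamma>\<^sub>l \<in> {0<..s\<^sub>e} \<longrightarrow> entropy_condition (kirchhoff_P lam mu rho0) \<Gamma>\<^sub>l) \<and>
              (1 + \<Gamma>\<^sub>l \<in> {s\<^sub>e<..<1} \<longrightarrow> \<not> entropy_condition (kirchhoff_P lam mu rho0) \<Gamma>\<^sub>l))))"
proof (intro conjI impI)
  have iff: "entropy_condition (kirchhoff_P lam mu rho0) g \<longleftrightarrow> kirchhoff_ratio (1 + g) \<le> alpha"
    if "g \<in> {-1<..<0}" for g
    using that assms entropy_condition_kirchhoff_iff by auto
  show "\<forall>g\<in>{-1<..<0}. entropy_condition (kirchhoff_P lam mu rho0) g" if "alpha \<ge> 2"
  proof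
    fix g :: real assume "g \<in> {-1<..<0}"
    then show "entropy_condition (kirchhoff_P lam mu rho0) g"
      using kirchhoff_ratio_less_2[of "1 + g"] iff[of g] that by auto
  qed
  show "\<exists>!s. s \<in> {0<..<1} \<and>
      s * (s + 1) * (1 - s) ^ 3 / (2 * (s - 1 - s * ln s) * ln s) = alpha"
    if "0 < alpha \<and> alpha < 2"
    unfolding kirchhoff_ratio_def[symmetric]
    using kirchhoff_ratio_surj[of alpha] that
      strict_mono_on_imp_inj_on[OF kirchhoff_ratio_strict_mono]
    by (metis inj_onD)
  show "\<forall>s. s \<in> {0<..<1} \<and>
      s * (s + 1) * (1 - s) ^ 3 / (2 * (s - 1 - s * ln s) * ln s) = alpha \<longrightarrow>
      (\<forall>g\<in>{-1<..<0}.
        (1 + g \<in> {0<..s} \<longrightarrow> entropy_condition (kirchhoff_P lam mu rho0) g) \<and>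
        (1 + g \<in> {s<..<1} \<longrightarrow> \<not> entropy_condition (kirchhoff_P lam mu rho0) g))"
    unfolding kirchhoff_ratio_def[symmetric]
  proof (intro allI impI ballI)
    fix s g :: real
    assume s: "s \<in> {0<..<1} \<and> kirchhoff_ratio s = alpha" and g: "g \<in> {-1<..<0}"
    \<comment> \<open>A strictly increasing function also reflects the order. Since the inequality
      is weak, the root s itself falls on the admissible side.\<close>
    then have "kirchhoff_ratio (1 + g) \<le> kirchhoff_ratio s \<longleftrightarrow> 1 + g \<le> s"
      by (intro strict_mono_on_less_eq[OF kirchhoff_ratio_strict_mono]) auto
    then show "(1 + g \<in> {0<..s} \<longrightarrow> entropy_condition (kirchhoff_P lam mu rho0) g) \<and>
        (1 + g \<in> {s<..<1} \<longrightarrow> \<not> entropy_condition (kirchhoff_P lam mu rho0) g)"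
      using s iff[OF g] by auto
  qed
qed

end
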